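(* Let $X\subseteq\mathbb{C}$ be a perfect compact set which has infinitely many connected components, and let $M=(M_n)_{n\ge 0}$ be any sequence of positive real numbers. Then the normed space $D(X,M)$ is incomplete, and for every positive integer $n$ the normed space $D^n(X)$ is incomplete.
   Context: A perfect compact plane set is a non-empty compact subset of $\mathbb{C}$ without isolated points. For such $X$, a function $f:X\to\mathbb{C}$ is complex-differentiable at $a\in X$ if $f'(a)=\lim_{z\to a,\,z\in X\setminus\{a\}}\frac{f(z)-f(a)}{z-a}$ exists; higher complex derivatives $f^{(n)}$ on $X$ are defined by iteration, with $f^{(0)}=f$. $\|\cdot\|_\infty$ is the supremum norm on $X$. For a positive integer $n$, $D^n(X)$ is the space of $n$-times continuously complex-differentiable functions on $X$, with norm $\|f\|=\sum_{k=0}^n \frac{\|f^{(k)}\|_\infty}{k!}$. $D^\infty(X)$ is the set of infinitely complex-differentiable functions on $X$, and for a sequence $M=(M_n)_{n\ge0}$ of positive reals, $D(X,M)=\{f\in D^\infty(X): \|f\|=\sum_{n=0}^\infty \frac{\|f^{(n)}\|_\infty}{M_n}<\infty\}$ with this norm. *)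

theory Defs
  imports "HOL-Analysis.Analysis"
begin

definition perfect_compact :: "complex set \<Rightarrow> bool" where
  "perfect_compact X \<longleftrightarrow> X \<noteq> {} \<and> compact X \<and> (\<forall>a\<in>X. a islimpt X)"

text \<open>
  A function \<open>X \<rightarrow> \<complex>\<close> is represented by an extensional function, so that equality of
  representatives is equality on \<open>X\<close>. By definition of \<^const>\<open>has_field_derivative\<close>, the filter
  \<open>at a within X\<close> excludes the point \<open>a\<close>; for perfect \<open>X\<close> the derivative is unique.
\<close>

definition cderiv :: "complex set \<Rightarrow> (complex \<Rightarrow> complex) \<Rightarrow> complex \<Rightarrow> complex" where
  "cderiv X f = (\<lambda>a\<in>X. THE D. (f has_field_derivative D) (at a within X))"

definition cderiv_iter :: "complex set \<Rightarrow> nat \<Rightarrow> (complex \<Rightarrow> complex) \<Rightarrow> complex \<Rightarrow> complex" where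
  "cderiv_iter X k f = (cderiv X ^^ k) f"

definition cdiff_on :: "complex set \<Rightarrow> (complex \<Rightarrow> complex) \<Rightarrow> bool" where
  "cdiff_on X f \<longleftrightarrow> (\<forall>a\<in>X. f field_differentiable (at a within X))"

definition sup_norm :: "complex set \<Rightarrow> (complex \<Rightarrow> complex) \<Rightarrow> real" where
  "sup_norm X f = (SUP z\<in>X. cmod (f z))"

definition Dn :: "complex set \<Rightarrow> nat \<Rightarrow> (complex \<Rightarrow> complex) set" where
  "Dn X n = {f \<in> extensional X.
     (\<forall>k<n. cdiff_on X (cderiv_iter X k f)) \<and> continuous_on X (cderiv_iter X n f)}"

definition Dn_norm :: "complex set \<Rightarrow> nat \<Rightarrow> (complex \<Rightarrow> complex) \<Rightarrow> real" where
  "Dn_norm X n f = (\<Sum>k\<le>n. sup_norm X (cderiv_iter X k f) / fact k)"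

definition Dinf :: "complex set \<Rightarrow> (complex \<Rightarrow> complex) set" where
  "Dinf X = {f \<in> extensional X. \<forall>k. cdiff_on X (cderiv_iter X k f)}"

definition DM :: "complex set \<Rightarrow> (nat \<Rightarrow> real) \<Rightarrow> (complex \<Rightarrow> complex) set" where
  "DM X M = {f \<in> Dinf X. summable (\<lambda>k. sup_norm X (cderiv_iter X k f) / M k)}"

definition DM_norm :: "complex set \<Rightarrow> (nat \<Rightarrow> real) \<Rightarrow> (complex \<Rightarrow> complex) \<Rightarrow> real" where
  "DM_norm X M f = (\<Sum>k. sup_norm X (cderiv_iter X k f) / M k)"

text \<open>
  The metric that a norm \<open>N\<close> induces on a space \<open>V\<close> of functions on \<open>X\<close>. The locale
  \<^locale>\<open>Metric_space\<close> demands symmetry and nonnegativity for arbitrary arguments, hence the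
  value \<open>0\<close> outside \<open>V\<close>. The equation defining \<open>Metric_space.mcomplete\<close> is conditional on that
  locale; \<open>Metric_space_Dn\<close> and \<open>Metric_space_DM\<close> below discharge the condition.
\<close>

definition norm_dist ::
    "complex set \<Rightarrow> (complex \<Rightarrow> complex) set \<Rightarrow> ((complex \<Rightarrow> complex) \<Rightarrow> real) \<Rightarrow>
     (complex \<Rightarrow> complex) \<Rightarrow> (complex \<Rightarrow> complex) \<Rightarrow> real" where
  "norm_dist X V N f g = (if f \<in> V \<and> g \<in> V then N (\<lambda>z\<in>X. f z - g z) else 0)"

lemma cderiv_eqI:
  assumes "perfect_compact X" "a \<in> X" "(f has_field_derivative D) (at a within X)"
  shows "cderiv X f a = D"
proof -
  have nt: "at a within X \<noteq> bot"
    using assms by (auto simp: perfect_compact_def trivial_limit_within)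
  have "(THE D. (f has_field_derivative D) (at a within X)) = D"
    using assms(3) tendsto_unique[OF nt]
    by (intro the_equality) (auto simp: has_field_derivative_iff)
  then show ?thesis using assms(2) by (simp add: cderiv_def)
qed

lemma has_cderiv:
  assumes "perfect_compact X" "cdiff_on X f" "a \<in> X"
  shows "(f has_field_derivative cderiv X f a) (at a within X)"
  using assms cderiv_eqI unfolding cdiff_on_def field_differentiable_def by metis

lemma has_cderiv_diff:
  assumes "perfect_compact X" "cdiff_on X f" "cdiff_on X g" "a \<in> X"
  shows "((\<lambda>z\<in>X. f z - g z) has_field_derivative cderiv X f a - cderiv X g a) (at a within X)"
proof -
  have "((\<lambda>z. f z - g z) has_field_derivative cderiv X f a - cderiv X g a) (at a within X)"
    using assms by (intro derivative_intros has_cderiv)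
  then show ?thesis
    by (rule has_field_derivative_transform_within[where d = 1]) (use assms in auto)
qed

lemma cdiff_on_diff:
  assumes "perfect_compact X" "cdiff_on X f" "cdiff_on X g"
  shows "cdiff_on X (\<lambda>z\<in>X. f z - g z)"
  using has_cderiv_diff[OF assms] unfolding cdiff_on_def field_differentiable_def by blast

lemma cderiv_diff:
  assumes "perfect_compact X" "cdiff_on X f" "cdiff_on X g"
  shows "cderiv X (\<lambda>z\<in>X. f z - g z) = (\<lambda>z\<in>X. cderiv X f z - cderiv X g z)"
proof
  fix a
  show "cderiv X (\<lambda>z\<in>X. f z - g z) a = (\<lambda>z\<in>X. cderiv X f z - cderiv X g z) a"
  proof (cases "a \<in> X")
    case True
    then show ?thesis
      using cderiv_eqI[OF assms(1) True has_cderiv_diff[OF assms True]] by simp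
  qed (simp add: cderiv_def)
qed

lemma cderiv_iter_diff:
  assumes "perfect_compact X"
    and "\<And>j. j < k \<Longrightarrow> cdiff_on X (cderiv_iter X j f)"
    and "\<And>j. j < k \<Longrightarrow> cdiff_on X (cderiv_iter X j g)"
  shows "cderiv_iter X k (\<lambda>z\<in>X. f z - g z) = (\<lambda>z\<in>X. cderiv_iter X k f z - cderiv_iter X k g z)"
  using assms(2,3)
proof (induction k)
  case 0
  then show ?case by (simp add: cderiv_iter_def)
next
  case (Suc k)
  have "cderiv_iter X (Suc k) (\<lambda>z\<in>X. f z - g z) = cderiv X (cderiv_iter X k (\<lambda>z\<in>X. f z - g z))"
    by (simp add: cderiv_iter_def)
  also have "\<dots> = cderiv X (\<lambda>z\<in>X. cderiv_iter X k f z - cderiv_iter X k g z)"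
    using Suc by (intro arg_cong[where f = "cderiv X"]) (meson less_Suc_eq)
  also have "\<dots> = (\<lambda>z\<in>X. cderiv_iter X (Suc k) f z - cderiv_iter X (Suc k) g z)"
    using cderiv_diff[OF assms(1), of "cderiv_iter X k f" "cderiv_iter X k g"] Suc.prems
    by (simp add: cderiv_iter_def)
  finally show ?case .
qed

lemma cdiff_on_imp_continuous_on: "cdiff_on X f \<Longrightarrow> continuous_on X f"
  unfolding cdiff_on_def continuous_on_eq_continuous_within
  using field_differentiable_imp_continuous_at by blast

lemma bdd_above_cmod:
  assumes "perfect_compact X" "continuous_on X f"
  shows "bdd_above ((\<lambda>z. cmod (f z)) ` X)"
  using assms by (intro bounded_imp_bdd_above compact_imp_bounded compact_continuous_image
    continuous_intros) (auto simp: perfect_compact_def)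

lemma cmod_le_sup_norm:
  assumes "perfect_compact X" "continuous_on X f" "z \<in> X"
  shows "cmod (f z) \<le> sup_norm X f"
  unfolding sup_norm_def using bdd_above_cmod[OF assms(1,2)] assms(3) by (rule cSUP_upper2) auto

lemma sup_norm_leI:
  assumes "perfect_compact X" "\<And>z. z \<in> X \<Longrightarrow> cmod (f z) \<le> B"
  shows "sup_norm X f \<le> B"
  unfolding sup_norm_def using assms by (intro cSUP_least) (auto simp: perfect_compact_def)

lemma sup_norm_nonneg:
  assumes "perfect_compact X" "continuous_on X f"
  shows "0 \<le> sup_norm X f"
proof -
  obtain z where "z \<in> X" using assms(1) by (auto simp: perfect_compact_def)
  then show ?thesis using cmod_le_sup_norm[OF assms] norm_ge_zero order_trans by blast
qed

lemma continuous_on_rdiff: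
  assumes "continuous_on X f" "continuous_on X (g :: complex \<Rightarrow> complex)"
  shows "continuous_on X (\<lambda>z\<in>X. f z - g z)"
proof -
  have "continuous_on X (\<lambda>z. f z - g z)" using assms by (intro continuous_intros)
  then show ?thesis by (rule continuous_on_eq) auto
qed

lemma sup_norm_triangle:
  assumes "perfect_compact X" "continuous_on X f" "continuous_on X g" "continuous_on X h"
  shows "sup_norm X (\<lambda>z\<in>X. f z - h z) \<le>
    sup_norm X (\<lambda>z\<in>X. f z - g z) + sup_norm X (\<lambda>z\<in>X. g z - h z)"
proof (rule sup_norm_leI[OF assms(1)])
  fix z assume z: "z \<in> X"
  have "cmod (f z - h z) \<le> cmod (f z - g z) + cmod (g z - h z)"
    using norm_triangle_ineq[of "f z - g z" "g z - h z"] by simp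
  then show "cmod ((\<lambda>z\<in>X. f z - h z) z) \<le>
    sup_norm X (\<lambda>z\<in>X. f z - g z) + sup_norm X (\<lambda>z\<in>X. g z - h z)"
    using cmod_le_sup_norm[OF assms(1) continuous_on_rdiff[OF assms(2,3)] z]
      cmod_le_sup_norm[OF assms(1) continuous_on_rdiff[OF assms(3,4)] z] z by simp
qed

lemma sup_norm_diff_le:
  assumes "perfect_compact X" "continuous_on X f" "continuous_on X g"
  shows "sup_norm X (\<lambda>z\<in>X. f z - g z) \<le> sup_norm X f + sup_norm X g"
proof (rule sup_norm_leI[OF assms(1)])
  fix z assume z: "z \<in> X"
  have "cmod (f z - g z) \<le> cmod (f z) + cmod (g z)" by (rule norm_triangle_ineq4)
  then show "cmod ((\<lambda>z\<in>X. f z - g z) z) \<le> sup_norm X f + sup_norm X g"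
    using cmod_le_sup_norm[OF assms(1,2) z] cmod_le_sup_norm[OF assms(1,3) z] z by simp
qed

lemma sup_norm_rdiff_self: "perfect_compact X \<Longrightarrow> sup_norm X (\<lambda>z\<in>X. f z - f z) = 0"
  by (simp add: sup_norm_def perfect_compact_def)

lemma sup_norm_commute: "sup_norm X (\<lambda>z\<in>X. f z - g z) = sup_norm X (\<lambda>z\<in>X. g z - f z)"
  unfolding sup_norm_def by (intro SUP_cong) (auto simp: norm_minus_commute)

lemma sup_norm_rdiff_eq_0D:
  assumes "perfect_compact X" "continuous_on X f" "continuous_on X g"
    "f \<in> extensional X" "g \<in> extensional X" "sup_norm X (\<lambda>z\<in>X. f z - g z) = 0"
  shows "f = g"
  using assms(4,5)
proof (rule extensionalityI)
  fix z assume "z \<in> X"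
  then show "f z = g z"
    using cmod_le_sup_norm[OF assms(1) continuous_on_rdiff[OF assms(2,3)], of z] assms(6) by simp
qed

lemma Dn_cont:
  assumes "f \<in> Dn X n" "k \<le> n"
  shows "continuous_on X (cderiv_iter X k f)"
  using assms cdiff_on_imp_continuous_on by (cases "k = n") (auto simp: Dn_def)

lemma Dn_iter_diff:
  assumes "perfect_compact X" "f \<in> Dn X n" "g \<in> Dn X n" "k \<le> n"
  shows "cderiv_iter X k (\<lambda>z\<in>X. f z - g z) = (\<lambda>z\<in>X. cderiv_iter X k f z - cderiv_iter X k g z)"
  using assms by (intro cderiv_iter_diff) (auto simp: Dn_def)

lemma Dn_diff:
  assumes "perfect_compact X" "f \<in> Dn X n" "g \<in> Dn X n"
  shows "(\<lambda>z\<in>X. f z - g z) \<in> Dn X n"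
proof -
  have "cdiff_on X (cderiv_iter X k (\<lambda>z\<in>X. f z - g z))" if "k < n" for k
    using that assms by (subst Dn_iter_diff[OF assms]) (auto intro!: cdiff_on_diff simp: Dn_def)
  moreover have "continuous_on X (cderiv_iter X n (\<lambda>z\<in>X. f z - g z))"
    by (subst Dn_iter_diff[OF assms order_refl])
       (intro continuous_on_rdiff Dn_cont[OF assms(2)] Dn_cont[OF assms(3)] order_refl)
  ultimately show ?thesis by (simp add: Dn_def)
qed

lemma Metric_space_norm_dist:
  assumes "\<And>f g. f \<in> V \<Longrightarrow> g \<in> V \<Longrightarrow> 0 \<le> N (\<lambda>z\<in>X. f z - g z)"
    and "\<And>f g. f \<in> V \<Longrightarrow> g \<in> V \<Longrightarrow> N (\<lambda>z\<in>X. f z - g z) = N (\<lambda>z\<in>X. g z - f z)"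
    and "\<And>f. f \<in> V \<Longrightarrow> N (\<lambda>z\<in>X. f z - f z) = 0"
    and "\<And>f g. f \<in> V \<Longrightarrow> g \<in> V \<Longrightarrow> N (\<lambda>z\<in>X. f z - g z) = 0 \<Longrightarrow> f = g"
    and "\<And>f g h. f \<in> V \<Longrightarrow> g \<in> V \<Longrightarrow> h \<in> V \<Longrightarrow>
      N (\<lambda>z\<in>X. f z - h z) \<le> N (\<lambda>z\<in>X. f z - g z) + N (\<lambda>z\<in>X. g z - h z)"
  shows "Metric_space V (norm_dist X V N)"
proof (rule Metric_space.intro)
  fix f g h
  show "0 \<le> norm_dist X V N f g" using assms(1) by (simp add: norm_dist_def)
  show "norm_dist X V N f g = norm_dist X V N g f" using assms(2)[of f g] by (simp add: norm_dist_def)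
  assume fg: "f \<in> V" "g \<in> V"
  show "norm_dist X V N f g = 0 \<longleftrightarrow> f = g"
    using assms(3)[of f] assms(4)[of f g] fg by (auto simp: norm_dist_def)
  assume "h \<in> V"
  then show "norm_dist X V N f h \<le> norm_dist X V N f g + norm_dist X V N g h"
    using assms(5)[of f g h] fg by (simp add: norm_dist_def)
qed

lemma Dn_norm_diff:
  assumes "perfect_compact X" "f \<in> Dn X n" "g \<in> Dn X n"
  shows "Dn_norm X n (\<lambda>z\<in>X. f z - g z) =
    (\<Sum>k\<le>n. sup_norm X (\<lambda>z\<in>X. cderiv_iter X k f z - cderiv_iter X k g z) / fact k)"
  unfolding Dn_norm_def by (rule sum.cong[OF refl]) (simp add: Dn_iter_diff[OF assms])

lemma Metric_space_Dn:
  assumes X: "perfect_compact X"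
  shows "Metric_space (Dn X n) (norm_dist X (Dn X n) (Dn_norm X n))"
proof (rule Metric_space_norm_dist)
  fix f g h
  assume f: "f \<in> Dn X n"
  show "Dn_norm X n (\<lambda>z\<in>X. f z - f z) = 0"
    by (simp only: Dn_norm_diff[OF X f f] sup_norm_rdiff_self[OF X]) simp
  assume g: "g \<in> Dn X n"
  note cont = Dn_cont[OF f] Dn_cont[OF g]
  have nonneg: "0 \<le> sup_norm X (\<lambda>z\<in>X. cderiv_iter X k f z - cderiv_iter X k g z) / fact k"
    if "k \<le> n" for k
    by (intro divide_nonneg_pos sup_norm_nonneg X continuous_on_rdiff cont that) simp
  show "0 \<le> Dn_norm X n (\<lambda>z\<in>X. f z - g z)"
    unfolding Dn_norm_diff[OF X f g] using nonneg by (intro sum_nonneg) auto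
  show "Dn_norm X n (\<lambda>z\<in>X. f z - g z) = Dn_norm X n (\<lambda>z\<in>X. g z - f z)"
    unfolding Dn_norm_diff[OF X f g] Dn_norm_diff[OF X g f]
    by (intro sum.cong refl arg_cong2[where f = "(/)"] sup_norm_commute)
  show "f = g" if "Dn_norm X n (\<lambda>z\<in>X. f z - g z) = 0"
  proof -
    have "sup_norm X (\<lambda>z\<in>X. cderiv_iter X 0 f z - cderiv_iter X 0 g z) / fact 0 = 0"
      using that nonneg unfolding Dn_norm_diff[OF X f g]
      by (subst (asm) sum_nonneg_eq_0_iff) auto
    then have "sup_norm X (\<lambda>z\<in>X. f z - g z) = 0" by (simp add: cderiv_iter_def)
    moreover have "continuous_on X f" "continuous_on X g"
      using cont[of 0] by (auto simp: cderiv_iter_def)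
    ultimately show ?thesis
      using f g sup_norm_rdiff_eq_0D[OF X, of f g] by (auto simp: Dn_def)
  qed
  assume h: "h \<in> Dn X n"
  show "Dn_norm X n (\<lambda>z\<in>X. f z - h z) \<le>
      Dn_norm X n (\<lambda>z\<in>X. f z - g z) + Dn_norm X n (\<lambda>z\<in>X. g z - h z)"
    unfolding Dn_norm_diff[OF X f g] Dn_norm_diff[OF X g h] Dn_norm_diff[OF X f h]
      sum.distrib[symmetric] add_divide_distrib[symmetric]
    by (intro sum_mono divide_right_mono sup_norm_triangle X cont Dn_cont[OF h]) auto
qed

lemma DM_cdiff: "f \<in> DM X M \<Longrightarrow> cdiff_on X (cderiv_iter X k f)"
  by (simp add: DM_def Dinf_def)

lemma DM_cont: "f \<in> DM X M \<Longrightarrow> continuous_on X (cderiv_iter X k f)"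
  by (intro cdiff_on_imp_continuous_on DM_cdiff)

lemma DM_iter_diff:
  assumes "perfect_compact X" "f \<in> DM X M" "g \<in> DM X M"
  shows "cderiv_iter X k (\<lambda>z\<in>X. f z - g z) = (\<lambda>z\<in>X. cderiv_iter X k f z - cderiv_iter X k g z)"
  using assms DM_cdiff by (intro cderiv_iter_diff) auto

lemma DM_summable_diff:
  assumes X: "perfect_compact X" and M: "\<And>k. 0 < M k" and f: "f \<in> DM X M" and g: "g \<in> DM X M"
  shows "summable (\<lambda>k. sup_norm X (\<lambda>z\<in>X. cderiv_iter X k f z - cderiv_iter X k g z) / M k)"
proof (rule summable_comparison_test')
  show "summable (\<lambda>k. sup_norm X (cderiv_iter X k f) / M k + sup_norm X (cderiv_iter X k g) / M k)"
    using f g by (intro summable_add) (auto simp: DM_def)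
  fix k :: nat assume "0 \<le> k"
  have "0 \<le> sup_norm X (\<lambda>z\<in>X. cderiv_iter X k f z - cderiv_iter X k g z)"
    by (intro sup_norm_nonneg X continuous_on_rdiff DM_cont[OF f] DM_cont[OF g])
  then show "norm (sup_norm X (\<lambda>z\<in>X. cderiv_iter X k f z - cderiv_iter X k g z) / M k) \<le>
      sup_norm X (cderiv_iter X k f) / M k + sup_norm X (cderiv_iter X k g) / M k"
    using sup_norm_diff_le[OF X DM_cont[OF f, of k] DM_cont[OF g, of k]] M[of k]
    by (simp add: add_divide_distrib[symmetric] divide_right_mono)
qed

lemma DM_diff:
  assumes "perfect_compact X" "\<And>k. 0 < M k" "f \<in> DM X M" "g \<in> DM X M"
  shows "(\<lambda>z\<in>X. f z - g z) \<in> DM X M"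
proof -
  have "cdiff_on X (cderiv_iter X k (\<lambda>z\<in>X. f z - g z))" for k
    unfolding DM_iter_diff[OF assms(1,3,4)] using assms DM_cdiff by (intro cdiff_on_diff) auto
  then show ?thesis
    using DM_summable_diff[OF assms] by (simp add: DM_def Dinf_def DM_iter_diff[OF assms(1,3,4)])
qed

lemma DM_norm_diff:
  assumes "perfect_compact X" "f \<in> DM X M" "g \<in> DM X M"
  shows "DM_norm X M (\<lambda>z\<in>X. f z - g z) =
    (\<Sum>k. sup_norm X (\<lambda>z\<in>X. cderiv_iter X k f z - cderiv_iter X k g z) / M k)"
  unfolding DM_norm_def by (simp add: DM_iter_diff[OF assms])

lemma Metric_space_DM:
  assumes X: "perfect_compact X" and M: "\<And>k. 0 < M k"
  shows "Metric_space (DM X M) (norm_dist X (DM X M) (DM_norm X M))"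
proof (rule Metric_space_norm_dist)
  fix f g h
  assume f: "f \<in> DM X M"
  show "DM_norm X M (\<lambda>z\<in>X. f z - f z) = 0"
    by (simp only: DM_norm_diff[OF X f f] sup_norm_rdiff_self[OF X]) simp
  assume g: "g \<in> DM X M"
  note cont = DM_cont[OF f] DM_cont[OF g] and summ = DM_summable_diff[OF X M]
  have nonneg: "0 \<le> sup_norm X (\<lambda>z\<in>X. cderiv_iter X k f z - cderiv_iter X k g z) / M k" for k
    by (intro divide_nonneg_pos sup_norm_nonneg X continuous_on_rdiff cont M)
  show "0 \<le> DM_norm X M (\<lambda>z\<in>X. f z - g z)"
    unfolding DM_norm_diff[OF X f g] by (intro suminf_nonneg summ[OF f g] nonneg)
  show "DM_norm X M (\<lambda>z\<in>X. f z - g z) = DM_norm X M (\<lambda>z\<in>X. g z - f z)"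
    unfolding DM_norm_diff[OF X f g] DM_norm_diff[OF X g f]
    by (intro arg_cong[where f = suminf] ext arg_cong2[where f = "(/)"] sup_norm_commute refl)
  show "f = g" if "DM_norm X M (\<lambda>z\<in>X. f z - g z) = 0"
  proof -
    have "sup_norm X (\<lambda>z\<in>X. cderiv_iter X 0 f z - cderiv_iter X 0 g z) / M 0 = 0"
      using that suminf_eq_zero_iff[OF summ[OF f g] nonneg] unfolding DM_norm_diff[OF X f g] by blast
    then have "sup_norm X (\<lambda>z\<in>X. f z - g z) = 0"
      using M[of 0] by (simp add: cderiv_iter_def)
    moreover have "continuous_on X f" "continuous_on X g"
      using cont[of 0] by (auto simp: cderiv_iter_def)
    ultimately show ?thesis
      using f g sup_norm_rdiff_eq_0D[OF X, of f g] by (auto simp: DM_def Dinf_def)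
  qed
  assume h: "h \<in> DM X M"
  show "DM_norm X M (\<lambda>z\<in>X. f z - h z) \<le>
      DM_norm X M (\<lambda>z\<in>X. f z - g z) + DM_norm X M (\<lambda>z\<in>X. g z - h z)"
    unfolding DM_norm_diff[OF X f g] DM_norm_diff[OF X g h] DM_norm_diff[OF X f h]
      suminf_add[OF summ[OF f g] summ[OF g h]]
  proof (intro suminf_le summable_add summ f g h)
    fix k
    show "sup_norm X (\<lambda>z\<in>X. cderiv_iter X k f z - cderiv_iter X k h z) / M k \<le>
      sup_norm X (\<lambda>z\<in>X. cderiv_iter X k f z - cderiv_iter X k g z) / M k +
      sup_norm X (\<lambda>z\<in>X. cderiv_iter X k g z - cderiv_iter X k h z) / M k"
      unfolding add_divide_distrib[symmetric]
      by (intro divide_right_mono sup_norm_triangle X cont DM_cont[OF h] less_imp_le[OF M])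
  qed
qed

end

theory Submission
  imports Defs
begin

text \<open>
  Infinitely many components of the compact set \<open>X\<close> accumulate at some \<open>a \<in> X\<close>, so there are
  points \<open>z j \<rightarrow> a\<close>, with \<open>dist (z j) a < (1/4)^j\<close>, and relatively clopen sets \<open>T j\<close> that contain
  \<open>z j\<close> but not \<open>a\<close>. The partial sums of \<open>\<Sum>j. (1/2)^j 1\<^bsub>T j\<^esub>\<close> are locally constant, so all their
  derivatives vanish and in either norm they form a Cauchy sequence. Their pointwise limit \<open>g\<close>
  satisfies \<open>g a = 0\<close> and \<open>\<bar>g (z j)\<bar> \<ge> (1/2)^j\<close>, so it is not differentiable at \<open>a\<close>.
\<close>

section \<open>Accumulation of components and separation by clopen sets\<close>

text \<open>One representative per component gives an infinite subset of a compact set, hence a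
  limit point \<open>a\<close>. In a compact set each component is the intersection of the
  relatively clopen sets containing it (Sura-Bura), so every component other than that of
  \<open>a\<close> lies in a clopen set avoiding \<open>a\<close>.\<close>

lemma infinite_components_islimpt_clopen:
  fixes X :: "'a::euclidean_space set"
  assumes "compact X" "infinite (components X)"
  obtains a where "a \<in> X"
    and "a islimpt {x. \<exists>T. openin (top_of_set X) T \<and> closedin (top_of_set X) T \<and> x \<in> T \<and> a \<notin> T}"
proof -
  define r where "r C = (SOME x. x \<in> C)" for C :: "'a set"
  have r: "r C \<in> C" if "C \<in> components X" for C
    unfolding r_def using in_components_nonempty[OF that] by (simp add: some_in_eq)
  have eqI: "C = C'" if "C \<in> components X" "C' \<in> components X" "x \<in> C" "x \<in> C'" for C C' x
    using components_nonoverlap[OF that(1,2)] that(3,4) by blast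
  define S where "S = r ` components X"
  have "inj_on r (components X)"
    by (rule inj_onI) (metis r eqI)
  then have "infinite S"
    unfolding S_def using assms(2) finite_image_iff by blast
  moreover have "S \<subseteq> X"
    unfolding S_def using r in_components_subset by blast
  ultimately obtain a where a: "a \<in> X" "a islimpt S"
    using assms(1) unfolding compact_eq_Bolzano_Weierstrass by blast
  obtain C0 where C0: "C0 \<in> components X" "a \<in> C0"
    using a(1) Union_components by blast
  \<comment> \<open>The representative of the component of \<open>a\<close> cannot be separated from
    \<open>a\<close>. It is a single point, so removing it leaves \<open>a\<close> a limit
    point.\<close>
  have sub: "S \<subseteq> insert (r C0)
    {x. \<exists>T. openin (top_of_set X) T \<and> closedin (top_of_set X) T \<and> x \<in> T \<and> a \<notin> T}"
  proof
    fix x assume "x \<in> S"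
    then obtain C where C: "C \<in> components X" "x = r C" unfolding S_def by blast
    show "x \<in> insert (r C0)
      {x. \<exists>T. openin (top_of_set X) T \<and> closedin (top_of_set X) T \<and> x \<in> T \<and> a \<notin> T}"
    proof (cases "C = C0")
      case False
      then have "a \<notin> C" using eqI C(1) C0 by blast
      then obtain T where "C \<subseteq> T" "openin (top_of_set X) T" "closedin (top_of_set X) T" "a \<notin> T"
        using Sura_Bura_compact[OF assms(1) C(1)] by blast
      then show ?thesis using r[OF C(1)] C(2) by blast
    qed (use C in blast)
  qed
  show thesis
    using that[OF a(1)] islimpt_subset[OF a(2) sub] by (simp only: islimpt_insert)
qed

section \<open>Functions with vanishing derivative\<close>

text \<open>Local constancy implies the derivative condition, which is all that the norms see.
  Extensionality is included because members of \<open>Dn\<close> and \<open>DM\<close> are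
  extensional.\<close>

definition zero_deriv :: "complex set \<Rightarrow> (complex \<Rightarrow> complex) \<Rightarrow> bool" where
  "zero_deriv X f \<longleftrightarrow> f \<in> extensional X \<and> (\<forall>a\<in>X. (f has_field_derivative 0) (at a within X))"

lemma has_field_derivative_indicator_clopen:
  fixes T :: "'a::real_normed_field set"
  assumes "openin (top_of_set X) T" "closedin (top_of_set X) T" "a \<in> X"
  shows "(indicator T has_field_derivative (0::'a)) (at a within X)"
proof -
  \<comment> \<open>\<open>U\<close> is \<open>T\<close> or \<open>X - T\<close>: openness of
    \<open>T\<close> serves the first case, closedness the second.\<close>
  obtain U where U: "openin (top_of_set X) U" "a \<in> U"
    and eq: "\<And>z. z \<in> U \<Longrightarrow> indicator T z = (indicator T a :: 'a)"
  proof (cases "a \<in> T")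
    case True
    then show ?thesis using that[of T] assms(1) by (simp add: indicator_def)
  next
    case False
    then show ?thesis
      using that[of "X - T"] assms(2,3) by (simp add: indicator_def closedin_def)
  qed
  obtain d where d: "d > 0" "\<And>z. z \<in> X \<Longrightarrow> dist z a < d \<Longrightarrow> z \<in> U"
    using U unfolding openin_euclidean_subtopology_iff by blast
  show ?thesis
  proof (rule has_field_derivative_transform_within[where f = "\<lambda>_. indicator T a"])
    show "indicator T a = (indicator T z :: 'a)" if "z \<in> X" "dist z a < d" for z
      using eq[OF d(2)[OF that]] by (rule sym)
  qed (use d(1) assms(3) in simp_all)
qed

lemma zero_deriv_clopen_sum:
  assumes "\<And>j. openin (top_of_set X) (T j)" "\<And>j. closedin (top_of_set X) (T j)"
  shows "zero_deriv X (\<lambda>z\<in>X. \<Sum>j\<in>J. c j * indicator (T j) z)"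
  unfolding zero_deriv_def
proof (intro conjI ballI)
  fix a assume a: "a \<in> X"
  have "((\<lambda>z. \<Sum>j\<in>J. c j * indicator (T j) z) has_field_derivative (\<Sum>j\<in>J. c j * 0)) (at a within X)"
    by (intro DERIV_sum DERIV_cmult has_field_derivative_indicator_clopen assms a)
  then have "((\<lambda>z. \<Sum>j\<in>J. c j * indicator (T j) z) has_field_derivative 0) (at a within X)"
    by simp
  then show "((\<lambda>z\<in>X. \<Sum>j\<in>J. c j * indicator (T j) z) has_field_derivative 0) (at a within X)"
    by (rule has_field_derivative_transform_within[where d = 1]) (use a in auto)
qed simp

lemma zero_deriv_cdiff_on: "zero_deriv X f \<Longrightarrow> cdiff_on X f"
  unfolding zero_deriv_def cdiff_on_def field_differentiable_def by blast

lemma zero_deriv_diff: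
  assumes "zero_deriv X f" "zero_deriv X g"
  shows "zero_deriv X (\<lambda>z\<in>X. f z - g z)"
  unfolding zero_deriv_def
proof (intro conjI ballI)
  fix a assume a: "a \<in> X"
  have "((\<lambda>z. f z - g z) has_field_derivative 0 - 0) (at a within X)"
    using assms a unfolding zero_deriv_def by (intro DERIV_diff) auto
  then have "((\<lambda>z. f z - g z) has_field_derivative 0) (at a within X)" by simp
  then show "((\<lambda>z\<in>X. f z - g z) has_field_derivative 0) (at a within X)"
    by (rule has_field_derivative_transform_within[where d = 1]) (use a in auto)
qed simp

lemma cderiv_zero_deriv:
  assumes "perfect_compact X" "zero_deriv X f"
  shows "cderiv X f = (\<lambda>z\<in>X. 0)"
proof
  fix a show "cderiv X f a = (\<lambda>z\<in>X. 0) a"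
    using cderiv_eqI[OF assms(1), of a f 0] assms(2)
    by (cases "a \<in> X") (auto simp: zero_deriv_def cderiv_def)
qed

lemma zero_deriv_zero: "zero_deriv X (\<lambda>z\<in>X. 0)"
  using zero_deriv_clopen_sum[where T = "\<lambda>_. {}" and J = "{}"] by simp

text \<open>The first derivative is the zero function on \<open>X\<close>, which itself satisfies
  \<open>zero_deriv\<close>, so the argument repeats.\<close>

lemma cderiv_iter_zero_deriv:
  assumes "perfect_compact X" "zero_deriv X f" "0 < k"
  shows "cderiv_iter X k f = (\<lambda>z\<in>X. 0)"
  using assms(3)
proof (induction k)
  case (Suc k)
  have "cderiv_iter X (Suc k) f = cderiv X (cderiv_iter X k f)" by (simp add: cderiv_iter_def)
  also have "\<dots> = (\<lambda>z\<in>X. 0)"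
  \<comment> \<open>The induction hypothesis is vacuous at 0, so the first derivative is the true
    base case.\<close>
  proof (cases "k = 0")
    case True
    then show ?thesis using cderiv_zero_deriv[OF assms(1,2)] by (simp add: cderiv_iter_def)
  next
    case False
    then show ?thesis
      unfolding Suc.IH[OF neq0_conv[THEN iffD1, OF False]]
      by (intro cderiv_zero_deriv zero_deriv_zero assms(1))
  qed
  finally show ?case .
qed simp

lemma cdiff_on_cderiv_iter_zero_deriv:
  assumes "perfect_compact X" "zero_deriv X f"
  shows "cdiff_on X (cderiv_iter X k f)"
proof (cases "k = 0")
  case True
  then show ?thesis using assms(2) by (simp add: cderiv_iter_def zero_deriv_cdiff_on)
next
  case False
  then show ?thesis
    using zero_deriv_cdiff_on[OF zero_deriv_zero] by (simp add: cderiv_iter_zero_deriv[OF assms])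
qed

text \<open>On these functions either norm thus reduces to its term of index 0.\<close>

lemma sup_norm_cderiv_iter_zero_deriv:
  assumes "perfect_compact X" "zero_deriv X f"
  shows "sup_norm X (cderiv_iter X k f) = (if k = 0 then sup_norm X f else 0)"
proof (cases "k = 0")
  case False
  then show ?thesis
    using sup_norm_rdiff_self[OF assms(1), of "\<lambda>_. 0"]
    by (simp add: cderiv_iter_zero_deriv[OF assms])
qed (simp add: cderiv_iter_def)

section \<open>A criterion for incompleteness\<close>

text \<open>Along \<open>z j\<close> the difference quotients have norm at least
  \<open>(1/2)^j / (1/4)^j = 2^j\<close>, whereas differentiability would make them converge and so
  be bounded.\<close>

lemma unbounded_difference_quotient_not_differentiable:
  fixes g :: "'a::real_normed_field \<Rightarrow> 'a"
  assumes "\<And>j. z j \<in> X" "\<And>j. dist (z j) a < (1/4)^j" "g a = 0" "\<And>j. (1/2)^j \<le> norm (g (z j))"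
  shows "\<not> g field_differentiable (at a within X)"
proof
  assume "g field_differentiable (at a within X)"
  then obtain D where "(g has_field_derivative D) (at a within X)"
    unfolding field_differentiable_def by blast
  then have lim: "((\<lambda>y. (g y - g a) / (y - a)) \<longlongrightarrow> D) (at a within X)"
    by (simp add: has_field_derivative_iff)
  have za: "z j \<noteq> a" for j
  proof
    assume "z j = a"
    have "(0::real) < (1/2)^j" by simp
    also have "\<dots> \<le> norm (g (z j))" by (rule assms(4))
    finally show False using assms(3) \<open>z j = a\<close> by simp
  qed
  have "(\<lambda>j. dist (z j) a) \<longlonglongrightarrow> 0"
  proof (rule Lim_null_comparison)
    show "\<forall>\<^sub>F j in sequentially. norm (dist (z j) a) \<le> (1/4)^j"
      using assms(2) by (simp add: less_imp_le)
    show "(\<lambda>j. (1/4)^j :: real) \<longlonglongrightarrow> 0" by (rule LIMSEQ_power_zero) simp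
  qed
  then have "z \<longlonglongrightarrow> a" by (rule tendsto_dist_iff[THEN iffD2])
  then have "filterlim z (at a within X) sequentially"
    unfolding filterlim_at using assms(1) za by (intro conjI always_eventually) auto
  from filterlim_compose[OF lim this]
  have "(\<lambda>j. (g (z j) - g a) / (z j - a)) \<longlonglongrightarrow> D" .
  then have "Bseq (\<lambda>j. (g (z j) - g a) / (z j - a))"
    by (rule convergent_imp_Bseq[OF convergentI])
  then obtain K where K: "\<And>j. norm ((g (z j) - g a) / (z j - a)) \<le> K"
    unfolding Bseq_def by blast
  obtain j where j: "K < 2 ^ j"
    using real_arch_pow[of 2 K] by auto
  have pos: "0 < norm (z j - a)" using za[of j] by simp
  have "2 ^ j * norm (z j - a) \<le> 2 ^ j * (1/4)^j"
    using assms(2)[of j] by (intro mult_left_mono) (auto simp: dist_norm)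
  also have "\<dots> = (1/2 :: real)^j" by (simp flip: power_mult_distrib)
  also have "\<dots> \<le> norm (g (z j))" by (rule assms(4))
  finally have "2 ^ j \<le> norm (g (z j)) / norm (z j - a)"
    using pos by (simp add: le_divide_eq)
  then show False using K[of j] j assms(3) by (simp add: norm_divide)
qed

text \<open>The assumptions isolate what the two kinds of space share. \<open>le\<close> makes the
  partial sums Cauchy, \<open>ge\<close> identifies a limit in \<open>V\<close> with their pointwise
  limit, and \<open>diff\<close> then contradicts the behaviour of that limit at \<open>a\<close>.
  \<open>C\<close> is the weight dividing the sup norm of the function itself.\<close>

lemma not_mcomplete_of_zero_deriv:
  assumes X: "perfect_compact X" and inf: "infinite (components X)"
    and ms: "Metric_space V d"
    and V: "\<And>f. zero_deriv X f \<Longrightarrow> f \<in> V"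
    and diff: "\<And>f. f \<in> V \<Longrightarrow> cdiff_on X f"
    and C: "0 < C"
    and le: "\<And>f g. zero_deriv X f \<Longrightarrow> zero_deriv X g \<Longrightarrow>
      d f g \<le> sup_norm X (\<lambda>z\<in>X. f z - g z) / C"
    and ge: "\<And>f g z. f \<in> V \<Longrightarrow> g \<in> V \<Longrightarrow> z \<in> X \<Longrightarrow> cmod (f z - g z) / C \<le> d f g"
  shows "\<not> Metric_space.mcomplete V d"
proof
  interpret Metric_space V d by (rule ms)
  assume complete: mcomplete
  have "compact X" using X by (simp add: perfect_compact_def)
  then obtain a where a: "a \<in> X"
    "a islimpt {x. \<exists>T. openin (top_of_set X) T \<and> closedin (top_of_set X) T \<and> x \<in> T \<and> a \<notin> T}"
    by (rule infinite_components_islimpt_clopen[OF _ inf])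
  have "\<exists>z T. openin (top_of_set X) T \<and> closedin (top_of_set X) T \<and> z \<in> T \<and> a \<notin> T \<and>
      dist z a < (1/4)^j" for j :: nat
  proof -
    have "(0::real) < (1/4)^j" by simp
    with a(2) show ?thesis unfolding islimpt_approachable by blast
  qed
  then obtain z T where T: "\<And>j. openin (top_of_set X) (T j)" "\<And>j. closedin (top_of_set X) (T j)"
    and z: "\<And>j. z j \<in> T j" and aT: "\<And>j. a \<notin> T j" and dz: "\<And>j::nat. dist (z j) a < (1/4)^j"
    by metis
  have zX: "z j \<in> X" for j using z T(1) openin_imp_subset by blast
  define f where "f n = (\<lambda>x\<in>X. \<Sum>j<n. (1/2)^j * indicator (T j) x :: complex)" for n
  have f: "zero_deriv X (f n)" for n
    unfolding f_def by (rule zero_deriv_clopen_sum[OF T])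
  \<comment> \<open>Only the terms from \<open>m\<close> to \<open>n - 1\<close> survive, and each
    indicator is at most 1, so overlaps among the \<open>T j\<close> do no harm.\<close>
  have tail: "sup_norm X (\<lambda>x\<in>X. f n x - f m x) \<le> (\<Sum>j\<in>{m..<n}. (1/2)^j)" if "m \<le> n" for m n
  proof (rule sup_norm_leI[OF X])
    fix x assume x: "x \<in> X"
    have "f n x - f m x = (\<Sum>j\<in>{m..<n}. (1/2)^j * indicator (T j) x)"
      using x sum_diff_nat_ivl[OF le0 that, of "\<lambda>j. (1/2)^j * indicator (T j) x :: complex"]
      by (simp only: f_def restrict_apply' lessThan_atLeast0)
    also have "cmod \<dots> \<le> (\<Sum>j\<in>{m..<n}. (1/2)^j)"
      by (rule sum_norm_le) (simp add: norm_mult norm_power norm_divide indicator_def)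
    finally show "cmod ((\<lambda>x\<in>X. f n x - f m x) x) \<le> (\<Sum>j\<in>{m..<n}. (1/2)^j)" using x by simp
  qed
  have "MCauchy f"
    unfolding MCauchy_def
  proof (intro conjI allI impI)
    show "range f \<subseteq> V" using V f by blast
    fix e :: real assume "0 < e"
    moreover have "summable (\<lambda>j. (1/2 :: real)^j)" by (rule summable_geometric) simp
    \<comment> \<open>The threshold \<open>e * C\<close> compensates for the division by
      \<open>C\<close> in \<open>le\<close>.\<close>
    ultimately obtain N where "\<And>m n. N \<le> m \<Longrightarrow> norm (\<Sum>j\<in>{m..<n}. (1/2 :: real)^j) < e * C"
      using C unfolding summable_Cauchy by (meson mult_pos_pos)
    then have N: "(\<Sum>j\<in>{m..<n}. (1/2 :: real)^j) < e * C" if "N \<le> m" for m n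
      using that by (smt (verit) real_norm_def)
    have *: "d (f n) (f m) < e" if "N \<le> m" "m \<le> n" for m n
    proof -
      have "d (f n) (f m) \<le> sup_norm X (\<lambda>x\<in>X. f n x - f m x) / C" by (rule le[OF f f])
      also have "\<dots> < e"
        using tail[OF that(2)] N[OF that(1), of n] C by (simp add: divide_less_eq)
      finally show ?thesis .
    qed
    show "\<exists>N. \<forall>n n'. N \<le> n \<longrightarrow> N \<le> n' \<longrightarrow> d (f n) (f n') < e"
      using * commute by (metis nle_le)
  qed
  then obtain g where "limitin mtopology f g sequentially"
    using complete unfolding mcomplete_def by blast
  then have g: "g \<in> V" and lim: "\<And>e. e > 0 \<Longrightarrow> \<exists>N. \<forall>n\<ge>N. f n \<in> V \<and> d (f n) g < e"
    unfolding limit_metric_sequentially by blast+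
  \<comment> \<open>By \<open>ge\<close>, evaluation at a point of \<open>X\<close> is continuous
    for \<open>d\<close>, which determines \<open>g\<close> on \<open>X\<close>.\<close>
  have tend: "(\<lambda>n. f n x) \<longlonglongrightarrow> g x" if x: "x \<in> X" for x
  proof (rule metric_LIMSEQ_I)
    fix e :: real assume "0 < e"
    then obtain N where N: "\<And>n. n \<ge> N \<Longrightarrow> f n \<in> V \<and> d (f n) g < e / C"
      using lim[of "e / C"] C by auto
    have "dist (f n x) (g x) < e" if "n \<ge> N" for n
    proof -
      have "cmod (f n x - g x) / C < e / C"
        using ge[OF _ g x, of "f n"] N[OF that] by linarith
      then show ?thesis using C by (simp add: dist_norm divide_less_cancel)
    qed
    then show "\<exists>N. \<forall>n\<ge>N. dist (f n x) (g x) < e" by blast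
  qed
  have "g a = 0"
  proof (rule LIMSEQ_unique[OF tend[OF a(1)]])
    show "(\<lambda>n. f n a) \<longlonglongrightarrow> 0" using a(1) aT by (simp add: f_def)
  qed
  \<comment> \<open>All summands are nonnegative reals, so nothing cancels the term of index
    \<open>j\<close>. That term is present once \<open>n\<close> is at least \<open>Suc j\<close>,
    and the bound passes to the limit.\<close>
  moreover have "(1/2)^j \<le> cmod (g (z j))" for j
  proof (rule tendsto_lowerbound[OF tendsto_norm[OF tend[OF zX]]])
    show "\<forall>\<^sub>F n in sequentially. (1/2)^j \<le> cmod (f n (z j))"
    proof (rule eventually_sequentiallyI)
      fix n assume n: "Suc j \<le> n"
      have eq: "f n (z j) = of_real (\<Sum>i<n. (1/2)^i * indicator (T i) (z j))"
        using zX[of j] by (simp add: f_def of_real_indicator indicator_def)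
      have "(1/2)^j * indicator (T j) (z j) \<le> (\<Sum>i<n. (1/2)^i * indicator (T i) (z j) :: real)"
        using n by (intro member_le_sum) auto
      then show "(1/2)^j \<le> cmod (f n (z j))"
        using z[of j] unfolding eq norm_of_real by simp
    qed
  qed simp
  ultimately have "\<not> g field_differentiable (at a within X)"
    by (intro unbounded_difference_quotient_not_differentiable[OF zX dz])
  then show False using diff[OF g] a(1) unfolding cdiff_on_def by blast
qed

section \<open>The criterion applied to both kinds of space\<close>

lemma not_mcomplete_DM:
  assumes X: "perfect_compact X" and "infinite (components X)" and M: "\<And>k. 0 < M k"
  shows "\<not> Metric_space.mcomplete (DM X M) (norm_dist X (DM X M) (DM_norm X M))"
proof (rule not_mcomplete_of_zero_deriv[OF assms(1,2) Metric_space_DM[OF X M] _ _ M[of 0]])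
  \<comment> \<open>A series with at most one nonzero term converges for every \<open>M\<close>, so
    no growth condition on \<open>M\<close> arises.\<close>
  have sums: "(\<lambda>k. sup_norm X (cderiv_iter X k f) / M k) sums (sup_norm X f / M 0)"
    if "zero_deriv X f" for f
    using sums_single[of 0 "\<lambda>k. sup_norm X f / M k"]
    by (simp add: sup_norm_cderiv_iter_zero_deriv[OF X that] if_distrib[of "\<lambda>x. x / _"] cong: if_cong)
  show mem: "f \<in> DM X M" if "zero_deriv X f" for f
    using sums_summable[OF sums[OF that]] cdiff_on_cderiv_iter_zero_deriv[OF X that] that
    by (simp add: DM_def Dinf_def zero_deriv_def)
  show "cdiff_on X f" if "f \<in> DM X M" for f
    using DM_cdiff[OF that, of 0] by (simp add: cderiv_iter_def)
  show "norm_dist X (DM X M) (DM_norm X M) f g \<le> sup_norm X (\<lambda>z\<in>X. f z - g z) / M 0"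
    if "zero_deriv X f" "zero_deriv X g" for f g
    using sums_unique[OF sums[OF zero_deriv_diff[OF that]]] mem[OF that(1)] mem[OF that(2)]
    by (simp add: norm_dist_def DM_norm_def)
  show "cmod (f z - g z) / M 0 \<le> norm_dist X (DM X M) (DM_norm X M) f g"
    if f: "f \<in> DM X M" and g: "g \<in> DM X M" and z: "z \<in> X" for f g z
  proof -
    \<comment> \<open>The term of index 0 bounds the value of \<open>h\<close> at \<open>z\<close>,
      and the other terms of the norm are nonnegative.\<close>
    define h where "h = (\<lambda>z\<in>X. f z - g z)"
    have h: "h \<in> DM X M" unfolding h_def by (rule DM_diff[OF X M f g])
    have "cmod (h z) / M 0 \<le> sup_norm X (cderiv_iter X 0 h) / M 0"
      using cmod_le_sup_norm[OF X DM_cont[OF h, of 0] z] M[of 0]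
      by (simp add: cderiv_iter_def divide_right_mono)
    also have "\<dots> = (\<Sum>k\<in>{0}. sup_norm X (cderiv_iter X k h) / M k)" by simp
    also have "\<dots> \<le> DM_norm X M h"
      unfolding DM_norm_def
      using h M by (intro sum_le_suminf)
        (auto simp: DM_def intro!: divide_nonneg_pos sup_norm_nonneg[OF X] DM_cont[OF h])
    finally show ?thesis using f g z by (simp add: norm_dist_def h_def)
  qed
qed

lemma not_mcomplete_Dn:
  assumes X: "perfect_compact X" and "infinite (components X)" and n: "1 \<le> n"
  shows "\<not> Metric_space.mcomplete (Dn X n) (norm_dist X (Dn X n) (Dn_norm X n))"
proof (rule not_mcomplete_of_zero_deriv[OF assms(1,2) Metric_space_Dn[OF X] _ _ zero_less_one])
  show mem: "f \<in> Dn X n" if "zero_deriv X f" for f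
    using cdiff_on_cderiv_iter_zero_deriv[OF X that] that
    by (simp add: Dn_def zero_deriv_def cdiff_on_imp_continuous_on)
  show "cdiff_on X f" if "f \<in> Dn X n" for f
  proof -
    \<comment> \<open>Here \<open>1 \<le> n\<close> enters: index 0 lies below \<open>n\<close>, so
      members are differentiable and not merely continuous.\<close>
    have "cdiff_on X (cderiv_iter X 0 f)" using that n unfolding Dn_def by auto
    then show ?thesis by (simp add: cderiv_iter_def)
  qed
  have "Dn_norm X n f = sup_norm X f" if "zero_deriv X f" for f
  proof -
    have "Dn_norm X n f = (\<Sum>k\<le>n. if k = 0 then sup_norm X f else 0)"
      unfolding Dn_norm_def
      by (intro sum.cong) (auto simp: sup_norm_cderiv_iter_zero_deriv[OF X that])
    then show ?thesis by simp
  qed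
  then show "norm_dist X (Dn X n) (Dn_norm X n) f g \<le> sup_norm X (\<lambda>z\<in>X. f z - g z) / 1"
    if "zero_deriv X f" "zero_deriv X g" for f g
    using zero_deriv_diff[OF that] mem[OF that(1)] mem[OF that(2)]
    by (simp add: norm_dist_def)
  show "cmod (f z - g z) / 1 \<le> norm_dist X (Dn X n) (Dn_norm X n) f g"
    if f: "f \<in> Dn X n" and g: "g \<in> Dn X n" and z: "z \<in> X" for f g z
  proof -
    define h where "h = (\<lambda>z\<in>X. f z - g z)"
    have h: "h \<in> Dn X n" unfolding h_def by (rule Dn_diff[OF X f g])
    have "cmod (h z) \<le> sup_norm X (cderiv_iter X 0 h)"
      using cmod_le_sup_norm[OF X Dn_cont[OF h, of 0] z] by (simp add: cderiv_iter_def)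
    also have "\<dots> = (\<Sum>k\<in>{0}. sup_norm X (cderiv_iter X k h) / fact k)" by simp
    also have "\<dots> \<le> Dn_norm X n h"
      unfolding Dn_norm_def
      by (intro sum_mono2) (auto intro!: divide_nonneg_pos sup_norm_nonneg[OF X] Dn_cont[OF h])
    finally show ?thesis using f g z by (simp add: norm_dist_def h_def)
  qed
qed

theorem theorem2p3:
  fixes X :: "complex set" and M :: "nat \<Rightarrow> real"
  assumes "perfect_compact X"
    and "infinite (components X)"
    and "\<And>n. 0 < M n"
  shows "\<not> Metric_space.mcomplete (DM X M) (norm_dist X (DM X M) (DM_norm X M)) \<and>
    (\<forall>n\<ge>1. \<not> Metric_space.mcomplete (Dn X n) (norm_dist X (Dn X n) (Dn_norm X n)))"
proof (intro conjI allI impI)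
  show "\<not> Metric_space.mcomplete (DM X M) (norm_dist X (DM X M) (DM_norm X M))"
    by (rule not_mcomplete_DM[OF assms])
  show "\<not> Metric_space.mcomplete (Dn X n) (norm_dist X (Dn X n) (Dn_norm X n))" if "1 \<le> n" for n
    by (rule not_mcomplete_Dn[OF assms(1,2) that])
qed

end
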